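(* Let $n\ge1$ and let $a_1,\dots,a_n$ be integers with $a_1\ge1$ and $a_i\ge2$ for $i=2,\dots,n$. Then the snake $S(a_1,\dots,a_n)$ is isomorphic to the cycle (graphic) matroid of the multi-fan $F(c,d)$, where \[ c=\begin{cases}(a_1+1) & \text{if } n=1,\\ (a_1,a_3-1,\dots,a_{2k-1}-1,a_{2k+1}) & \text{if } n=2k+1>1,\\ (a_1,a_3-1,\dots,a_{2k-1}-1,1) & \text{if } n=2k>1,\end{cases} \qquad d=(a_2-1,a_4-1,\dots,a_{2k}-1) \] (with $d$ empty when $n=1$).
   Context: Lattice path matroids: a lattice path is a sequence of unit steps $N=(0,1)$ and $E=(1,0)$ from the origin. For lattice paths $P,Q$ from $(0,0)$ to $(m,r)$ with $P$ never above $Q$, encoding each path by the positions $\{s_1<\dots<s_r\}$ (for $P$) and $\{t_1<\dots<t_r\}$ (for $Q$) of its North steps among $\{1,\dots,m+r\}$, the lattice path matroid $M[P,Q]$ is the transversal matroid on $\{1,\dots,m+r\}$ with presentation $A_i=\{t_i,\dots,s_i\}$, $i=1,\dots,r$; equivalently its bases are the $r$-sets whose associated lattice path stays in the closed region (diagram) bounded by $P$ and $Q$. Snakes: an LPM $M[P,Q]$ is a snake if it has at least two elements, is connected (not a direct sum of two nonempty matroids), and its diagram contains no lattice point in its interior. For $n\ge1$, $a_1\ge1$, $a_i\ge2$ ($i\ge2$), $S(a_1,\dots,a_n)$ denotes the snake whose diagram, starting at the origin, consists of $a_1$ unit squares in a row to the right, then $a_2$ squares going up, then $a_3$ squares to the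 right, and so on alternating, up to $a_n$, where the last square of each group coincides with the first square of the next group. $S(1)$ (a single square) is the trivial snake. Multi-fans: for $\ell\ge1$ and vectors of positive integers $c=(c_1,\dots,c_\ell)$, $d=(d_1,\dots,d_{\ell-1})$, the multi-fan $F(c,d)$ is the multigraph consisting of a path $v_1,v_1^2,\dots,v_1^{d_1},v_2,v_2^2,\dots,v_2^{d_2},\dots,v_{\ell-1},v_{\ell-1}^2,\dots,v_{\ell-1}^{d_{\ell-1}},v_\ell$ (so $v_i$ and $v_{i+1}$ are joined by a path of $d_i$ edges) together with one extra vertex $x$ joined to each $v_i$ by a bundle of $c_i$ parallel edges. For $\ell=1$, $F(c_1)$ is a bundle of $c_1$ parallel edges between two vertices. *)

theory Defs
  imports Main
begin

section \<open>Matroids\<close>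

text \<open>
  A matroid is given by its ground set and its independent sets. The matroid axioms are not part of
  the type: all matroids below are transversal or graphic, and an isomorphism only refers to the
  ground sets and the independent sets.
\<close>

record 'a matroid =
  ground :: "'a set"
  indep :: "'a set set"

definition matroid_iso :: "'a matroid \<Rightarrow> 'b matroid \<Rightarrow> bool" where
  "matroid_iso M M' \<longleftrightarrow>
     (\<exists>f. bij_betw f (ground M) (ground M') \<and>
          (\<forall>X\<subseteq>ground M. X \<in> indep M \<longleftrightarrow> f ` X \<in> indep M'))"

definition direct_sum :: "'a matroid \<Rightarrow> 'a matroid \<Rightarrow> 'a matroid" where
  "direct_sum M1 M2 =
     \<lparr>ground = ground M1 \<union> ground M2, indep = {X \<union> Y |X Y. X \<in> indep M1 \<and> Y \<in> indep M2}\<rparr>"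

text \<open>
  If a matroid \<open>M\<close> is a direct sum as below, then the summands are restrictions of \<open>M\<close>, so they
  satisfy the matroid axioms automatically.
\<close>

definition connected_matroid :: "'a matroid \<Rightarrow> bool" where
  "connected_matroid M \<longleftrightarrow>
     \<not> (\<exists>M1 M2. ground M1 \<noteq> {} \<and> ground M2 \<noteq> {} \<and> ground M1 \<inter> ground M2 = {} \<and>
          indep M1 \<subseteq> Pow (ground M1) \<and> indep M2 \<subseteq> Pow (ground M2) \<and> M = direct_sum M1 M2)"

text \<open>The independent sets of a transversal matroid are the partial transversals of \<open>(A i)\<^bsub>i \<in> I\<^esub>\<close>.\<close>

definition transversal_matroid :: "'a set \<Rightarrow> 'i set \<Rightarrow> ('i \<Rightarrow> 'a set) \<Rightarrow> 'a matroid" where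
  "transversal_matroid S I A =
     \<lparr>ground = S,
      indep = {X. X \<subseteq> S \<and> (\<exists>f. inj_on f X \<and> (\<forall>x\<in>X. f x \<in> I \<and> x \<in> A (f x)))}\<rparr>"


section \<open>Lattice path matroids\<close>

datatype step = East | North

type_synonym lattice_path = "step list"

definition height :: "lattice_path \<Rightarrow> nat \<Rightarrow> nat" where
  "height P k = count_list (take k P) North"

text \<open>
  After \<open>k\<close> steps a path is at the point \<open>(k - height P k, height P k)\<close>, the only point of the path
  on the line \<open>x + y = k\<close>. Hence \<open>P\<close> is never above \<open>Q\<close> iff its height never exceeds that of \<open>Q\<close>,
  and a lattice point \<open>(x, y)\<close> is on or above \<open>P\<close> iff \<open>height P (x + y) \<le> y\<close>.
\<close>

definition path_pair :: "lattice_path \<Rightarrow> lattice_path \<Rightarrow> bool" where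
  "path_pair P Q \<longleftrightarrow>
     count_list P East = count_list Q East \<and> count_list P North = count_list Q North \<and>
     (\<forall>k \<le> length P. height P k \<le> height Q k)"

text \<open>The position of the \<open>i\<close>-th North step; positions and \<open>i\<close> are counted from 1.\<close>

definition north_pos :: "lattice_path \<Rightarrow> nat \<Rightarrow> nat" where
  "north_pos P i = filter (\<lambda>p. P ! (p - 1) = North) [1..<Suc (length P)] ! (i - 1)"

definition lpm :: "lattice_path \<Rightarrow> lattice_path \<Rightarrow> nat matroid" where
  "lpm P Q =
     transversal_matroid {1..length P} {1..count_list P North} (\<lambda>i. {north_pos Q i..north_pos P i})"

definition region_points :: "lattice_path \<Rightarrow> lattice_path \<Rightarrow> (nat \<times> nat) set" where
  "region_points P Q =
     {(x, y). x + y \<le> length P \<and> height P (x + y) \<le> y \<and> y \<le> height Q (x + y)}"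

text \<open>
  The unit squares of the diagram, each represented by its lower left corner: a unit square lies in
  the closed region bounded by \<open>P\<close> and \<open>Q\<close> iff its four corners do.
\<close>

definition diagram :: "lattice_path \<Rightarrow> lattice_path \<Rightarrow> (nat \<times> nat) set" where
  "diagram P Q =
     {(x, y). {(x, y), (Suc x, y), (x, Suc y), (Suc x, Suc y)} \<subseteq> region_points P Q}"

text \<open>
  A lattice point is in the interior of the diagram iff the four unit squares around it are in the
  diagram. Points on the coordinate axes are never interior.
\<close>

definition interior_points :: "lattice_path \<Rightarrow> lattice_path \<Rightarrow> (nat \<times> nat) set" where
  "interior_points P Q =
     {(Suc x, Suc y) |x y. {(x, y), (Suc x, y), (x, Suc y), (Suc x, Suc y)} \<subseteq> diagram P Q}"


section \<open>Snakes\<close>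

definition is_snake :: "lattice_path \<Rightarrow> lattice_path \<Rightarrow> bool" where
  "is_snake P Q \<longleftrightarrow>
     path_pair P Q \<and> 2 \<le> card (ground (lpm P Q)) \<and> connected_matroid (lpm P Q) \<and>
     interior_points P Q = {}"

fun turn :: "step \<Rightarrow> step" where
  "turn East = North"
| "turn North = East"

fun move :: "step \<Rightarrow> nat \<Rightarrow> nat \<times> nat \<Rightarrow> nat \<times> nat" where
  "move East k (x, y) = (x + k, y)"
| "move North k (x, y) = (x, y + k)"

text \<open>
  Groups of \<open>b\<close> squares in alternating directions, the first group having direction \<open>s\<close> and first
  square \<open>p\<close>; the last square of a group is the first square of the next one.
\<close>

fun squares_from :: "step \<Rightarrow> nat \<times> nat \<Rightarrow> nat list \<Rightarrow> (nat \<times> nat) set" where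
  "squares_from s p [] = {}"
| "squares_from s p (b # bs) =
     (\<lambda>k. move s k p) ` {..<b} \<union> squares_from (turn s) (move s (b - 1) p) bs"

definition snake_squares :: "nat list \<Rightarrow> (nat \<times> nat) set" where
  "snake_squares a = squares_from East (0, 0) a"

text \<open>
  \<open>snake a\<close> is \<open>S(a\<^sub>1, \<dots>, a\<^sub>n)\<close>. That the description is meaningful, and which boundary paths
  it determines, is shown in \<open>snake_paths_iff\<close> below.
\<close>

definition snake :: "nat list \<Rightarrow> nat matroid" where
  "snake a = (THE M. \<exists>P Q. is_snake P Q \<and> diagram P Q = snake_squares a \<and> M = lpm P Q)"


section \<open>Multi-fans and cycle matroids\<close>

text \<open>
  An undirected multigraph; \<open>ends G e\<close> is the set of the one (for a loop) or two end vertices of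
  the edge \<open>e\<close>.
\<close>

record ('v, 'e) multigraph =
  verts :: "'v set"
  edges :: "'e set"
  ends :: "'e \<Rightarrow> 'v set"

text \<open>
  Consecutive edges of a cycle share the listed vertices. A loop is a cycle of length 1, two parallel
  edges form a cycle of length 2.
\<close>

definition is_cycle :: "('v, 'e) multigraph \<Rightarrow> 'v list \<Rightarrow> 'e list \<Rightarrow> bool" where
  "is_cycle G vs es \<longleftrightarrow>
     es \<noteq> [] \<and> length vs = length es \<and> distinct vs \<and> distinct es \<and>
     set vs \<subseteq> verts G \<and> set es \<subseteq> edges G \<and>
     (\<forall>i < length es. ends G (es ! i) = {vs ! i, vs ! (Suc i mod length es)})"

definition cycle_matroid :: "('v, 'e) multigraph \<Rightarrow> 'e matroid" where
  "cycle_matroid G =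
     \<lparr>ground = edges G,
      indep = {X. X \<subseteq> edges G \<and> \<not> (\<exists>vs es. is_cycle G vs es \<and> set es \<subseteq> X)}\<rparr>"

text \<open>
  \<open>Hub\<close> is the vertex \<open>x\<close>, \<open>Rim i j\<close> is \<open>v\<^sub>i\<^sup>j\<close>, where \<open>v\<^sub>i\<^sup>1 = v\<^sub>i\<close>. \<open>Spoke i j\<close> is the \<open>j\<close>-th of
  the parallel edges between \<open>x\<close> and \<open>v\<^sub>i\<close>, and \<open>Path i j\<close> is the \<open>j\<close>-th edge of the path from
  \<open>v\<^sub>i\<close> to \<open>v\<^sub>i\<^sub>+\<^sub>1\<close>. All indices start from 1, hence \<open>c\<^sub>i = c ! (i - 1)\<close> and \<open>d\<^sub>i = d ! (i - 1)\<close>.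
\<close>

datatype fan_vertex = Hub | Rim nat nat

datatype fan_edge = Spoke nat nat | Path nat nat

fun fan_ends :: "nat list \<Rightarrow> fan_edge \<Rightarrow> fan_vertex set" where
  "fan_ends d (Spoke i j) = {Hub, Rim i 1}"
| "fan_ends d (Path i j) = {Rim i j, if j < d ! (i - 1) then Rim i (Suc j) else Rim (Suc i) 1}"

definition multi_fan :: "nat list \<Rightarrow> nat list \<Rightarrow> (fan_vertex, fan_edge) multigraph" where
  "multi_fan c d =
     \<lparr>verts = {Hub} \<union> {Rim i 1 |i. i \<in> {1..length c}}
              \<union> {Rim i j |i j. i \<in> {1..length d} \<and> j \<in> {1..d ! (i - 1)}},
      edges = {Spoke i j |i j. i \<in> {1..length c} \<and> j \<in> {1..c ! (i - 1)}}
              \<union> {Path i j |i j. i \<in> {1..length d} \<and> j \<in> {1..d ! (i - 1)}},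
      ends = fan_ends d\<rparr>"


section \<open>Well-definedness of snakes\<close>

lemma height_0 [simp]: "height P 0 = 0"
  by (simp add: height_def)

lemma height_le: "height P k \<le> k"
proof -
  have "count_list xs North \<le> length xs" for xs :: lattice_path
    by (induction xs) auto
  from this[of "take k P"] show ?thesis by (simp add: height_def)
qed

lemma height_Suc:
  "height P (Suc k) = height P k + (if k < length P \<and> P ! k = North then 1 else 0)"
  by (cases "k < length P") (simp_all add: height_def take_Suc_conv_app_nth)

lemma height_mono: "k \<le> l \<Longrightarrow> height P k \<le> height P l"
  by (rule lift_Suc_mono_le[of "height P"]) (simp_all add: height_Suc)

lemma height_length: "height P (length P) = count_list P North"
  by (simp add: height_def)

lemma count_East_North: "count_list P East + count_list P North = length P"
proof (induction P)
  case (Cons s P)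
  then show ?case by (cases s) auto
qed simp

lemma path_pair_iff:
  "path_pair P Q \<longleftrightarrow> length P = length Q \<and> height P (length P) = height Q (length P) \<and>
     (\<forall>k \<le> length P. height P k \<le> height Q k)"
  unfolding path_pair_def
  using count_East_North[of P] count_East_North[of Q] height_length[of P] height_length[of Q]
  by (auto; linarith)

lemma height_inject:
  assumes "length P = length Q" "\<And>k. k \<le> length P \<Longrightarrow> height P k = height Q k"
  shows "P = Q"
proof (rule nth_equalityI)
  fix i assume "i < length P"
  then have "height P i = height Q i" "height P (Suc i) = height Q (Suc i)"
    using assms by simp_all
  then have "P ! i = North \<longleftrightarrow> Q ! i = North"
    using \<open>i < length P\<close> assms(1) by (auto simp: height_Suc split: if_splits)
  then show "P ! i = Q ! i" by (metis step.exhaust)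
qed (rule assms)

lemma north_pos_le_iff:
  assumes "1 \<le> i" "i \<le> count_list P North" "x \<le> length P"
  shows "north_pos P i \<le> x \<longleftrightarrow> i \<le> height P x"
proof -
  define np where "np = (\<lambda>P. filter (\<lambda>p. P ! (p - 1) = North) [1..<Suc (length P)])"
  have np_snoc: "np (P @ [s]) = np P @ (if s = North then [Suc (length P)] else [])" for P s
  proof -
    have "filter (\<lambda>p. (P @ [s]) ! (p - 1) = North) [1..<Suc (length P)] = np P"
      unfolding np_def by (rule filter_cong) (auto simp: nth_append)
    then show ?thesis by (simp add: np_def)
  qed
  have len: "length (np P) = count_list P North" for P
    by (induction P rule: rev_induct) (simp add: np_def, simp add: np_snoc)
  have le: "np P ! j \<le> length P" if "j < count_list P North" for P j
  proof -
    have "np P ! j \<in> set (np P)" using that len by simp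
    then show ?thesis unfolding np_def by (simp del: upt_Suc)
  qed
  have "np P ! j \<le> x \<longleftrightarrow> Suc j \<le> height P x" if "j < count_list P North" "x \<le> length P" for j
    using that
  proof (induction P rule: rev_induct)
    case (snoc s P)
    consider "x \<le> length P" "j < count_list P North" | "x \<le> length P" "j \<ge> count_list P North"
      | "x = Suc (length P)" using snoc.prems by fastforce
    then show ?case
    proof cases
      case 1
      then show ?thesis using snoc.IH by (simp add: np_snoc nth_append len height_def)
    next
      case 2
      then have "s = North" "j = count_list P North" using snoc.prems by (auto split: if_splits)
      moreover have "height P x \<le> count_list P North"
        using height_mono[OF 2(1), of P] height_length by simp
      ultimately show ?thesis using 2 by (simp add: np_snoc nth_append len height_def)
    next
      case 3
      then show ?thesis using le[OF snoc.prems(1)] snoc.prems(1) by (simp add: height_def)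
    qed
  qed simp
  from this[of "i - 1"] show ?thesis
    using assms by (simp add: north_pos_def np_def)
qed

lemma mem_presentation_iff:
  assumes "path_pair P Q" "1 \<le> i" "i \<le> count_list P North" "1 \<le> x" "x \<le> length P"
  shows "x \<in> {north_pos Q i..north_pos P i} \<longleftrightarrow> height P (x - 1) < i \<and> i \<le> height Q x"
proof -
  have "length Q = length P" "count_list Q North = count_list P North"
    using assms(1) unfolding path_pair_iff by (metis, metis height_length)
  moreover have "x - 1 \<le> length P" using assms by linarith
  ultimately have "north_pos P i \<le> x - 1 \<longleftrightarrow> i \<le> height P (x - 1)" "north_pos Q i \<le> x \<longleftrightarrow> i \<le> height Q x"
    using north_pos_le_iff[of i P "x - 1"] north_pos_le_iff[of i Q x] assms by simp_all
  moreover have "x \<le> north_pos P i \<longleftrightarrow> \<not> north_pos P i \<le> x - 1" using assms(4) by linarith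
  ultimately show ?thesis by auto
qed

lemma indep_lpm_iff:
  assumes "path_pair P Q"
  shows "X \<in> indep (lpm P Q) \<longleftrightarrow> X \<subseteq> {1..length P} \<and>
    (\<exists>f. inj_on f X \<and> (\<forall>x\<in>X. f x \<in> {1..count_list P North} \<and>
           height P (x - 1) < f x \<and> f x \<le> height Q x))"
proof -
  have "(f x \<in> {1..count_list P North} \<and> x \<in> {north_pos Q (f x)..north_pos P (f x)}) \<longleftrightarrow>
        (f x \<in> {1..count_list P North} \<and> height P (x - 1) < f x \<and> f x \<le> height Q x)"
    if "x \<in> {1..length P}" for f :: "nat \<Rightarrow> nat" and x
    using mem_presentation_iff[OF assms, of "f x" x] that by auto
  then show ?thesis
    unfolding lpm_def transversal_matroid_def by (simp add: subset_iff) (meson+)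
qed

lemma ground_lpm [simp]: "ground (lpm P Q) = {1..length P}"
  by (simp add: lpm_def transversal_matroid_def)

lemma mem_diagram_iff:
  assumes "path_pair P Q"
  shows "(i, j) \<in> diagram P Q \<longleftrightarrow>
    i + j + 2 \<le> length P \<and> height P (Suc (i + j)) \<le> j \<and> j < height Q (Suc (i + j))"
proof
  assume "i + j + 2 \<le> length P \<and> height P (Suc (i + j)) \<le> j \<and> j < height Q (Suc (i + j))"
  then show "(i, j) \<in> diagram P Q"
    using height_Suc[of P "i + j"] height_Suc[of P "Suc (i + j)"]
      height_Suc[of Q "i + j"] height_Suc[of Q "Suc (i + j)"]
    by (auto simp: diagram_def region_points_def split: if_splits)
qed (auto simp: diagram_def region_points_def)

fun walk :: "step \<Rightarrow> nat list \<Rightarrow> lattice_path" where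
  "walk s [] = []"
| "walk s (b # bs) = replicate (b - 1) s @ walk (turn s) bs"

text \<open>
  The lower left corners of the squares of a snake form the path \<open>walk East a\<close>; the lower and the
  upper boundary path run through the lower right and the upper left corners, respectively.
\<close>

definition lower_path :: "nat list \<Rightarrow> lattice_path" where
  "lower_path a = East # walk East a @ [North]"

definition upper_path :: "nat list \<Rightarrow> lattice_path" where
  "upper_path a = North # walk East a @ [East]"

definition path_point :: "nat \<times> nat \<Rightarrow> lattice_path \<Rightarrow> nat \<times> nat" where
  "path_point p w = (fst p + count_list w East, snd p + count_list w North)"

lemma count_list_replicate: "count_list (replicate n x) y = (if x = y then n else 0)"
  by (induction n) auto

lemma path_point_replicate: "path_point p (replicate k s) = move s k p"
  by (cases p; cases s) (auto simp: path_point_def count_list_replicate)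

lemma path_point_append: "path_point p (u @ v) = path_point (path_point p u) v"
  by (simp add: path_point_def)

lemma squares_from_eq:
  assumes "bs \<noteq> []" "\<forall>b\<in>set bs. 1 \<le> b"
  shows "squares_from s p bs = (\<lambda>k. path_point p (take k (walk s bs))) ` {..length (walk s bs)}"
  using assms
proof (induction bs arbitrary: s p)
  case (Cons b bs)
  let ?w = "walk (turn s) bs"
  let ?r = "replicate (b - 1) s"
  have b: "1 \<le> b" using Cons by simp
  have part1: "(\<lambda>k. path_point p (take k (?r @ ?w))) ` {..<b} = (\<lambda>k. move s k p) ` {..<b}"
    by (rule image_cong) (auto simp: min_def path_point_replicate)
  show ?case
  proof (cases "bs = []")
    case True
    have "{..b - 1} = {..<b}" using b by auto
    then show ?thesis using True part1 by simp
  next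
    case False
    have IH: "squares_from (turn s) (move s (b - 1) p) bs
        = (\<lambda>k. path_point (move s (b - 1) p) (take k ?w)) ` {..length ?w}"
      using Cons False by simp
    have part2: "(\<lambda>k. path_point p (take k (?r @ ?w))) ` ((+) (b - 1) ` {..length ?w})
        = (\<lambda>k. path_point (move s (b - 1) p) (take k ?w)) ` {..length ?w}"
      unfolding image_image
      by (rule image_cong) (auto simp: path_point_append path_point_replicate)
    have "{..b - 1 + length ?w} = {..<b} \<union> (+) (b - 1) ` {..length ?w}"
    proof -
      have "(+) (b - 1) ` {..length ?w} = {b - 1..b - 1 + length ?w}"
        by (simp add: atMost_atLeast0)
      then show ?thesis using b by auto
    qed
    then have "(\<lambda>k. path_point p (take k (?r @ ?w))) ` {..b - 1 + length ?w} =
        (\<lambda>k. move s k p) ` {..<b} \<union> squares_from (turn s) (move s (b - 1) p) bs"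
      by (simp only: image_Un part1 part2 IH)
    then show ?thesis by simp
  qed
qed simp

lemma mem_snake_squares_iff:
  assumes "a \<noteq> []" "\<forall>b\<in>set a. 1 \<le> b"
  shows "(i, j) \<in> snake_squares a \<longleftrightarrow>
    i + j \<le> length (walk East a) \<and> j = height (walk East a) (i + j)"
proof -
  let ?w = "walk East a"
  have sum: "count_list (take k ?w) East + height ?w k = k" if "k \<le> length ?w" for k
    using count_East_North[of "take k ?w"] that by (simp add: height_def)
  have "(i, j) \<in> snake_squares a \<longleftrightarrow>
      (\<exists>k \<le> length ?w. i = count_list (take k ?w) East \<and> j = height ?w k)"
    unfolding snake_squares_def squares_from_eq[OF assms]
    by (auto simp: path_point_def height_def)
  also have "\<dots> \<longleftrightarrow> i + j \<le> length ?w \<and> j = height ?w (i + j)"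
    using sum sum[of "i + j"] by fastforce
  finally show ?thesis .
qed

lemma height_lower:
  "height (East # w @ [North]) (Suc k) = (if k \<le> length w then height w k else Suc (height w (length w)))"
  by (simp add: height_def)

lemma height_upper:
  "height (North # w @ [East]) (Suc k) = Suc (height w (min k (length w)))"
  by (auto simp: height_def min_def)

lemma not_connected_lpm:
  assumes "path_pair P Q" "0 < k" "k < length P" "height P k = height Q k"
  shows "\<not> connected_matroid (lpm P Q)"
proof -
  let ?n = "length P"
  define M where "M = (\<lambda>A. \<lparr>ground = A, indep = {X. X \<in> indep (lpm P Q) \<and> X \<subseteq> A}\<rparr>)"
  let ?M1 = "M {1..k}" and ?M2 = "M {Suc k..?n}"
  have sub: "X \<inter> A \<in> indep (lpm P Q)" if "X \<in> indep (lpm P Q)" for X A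
    using that unfolding indep_lpm_iff[OF assms(1)] by (meson Int_iff inf.coboundedI1 inj_on_Int)
  have join: "X \<union> Y \<in> indep (lpm P Q)"
    if X: "X \<in> indep (lpm P Q)" "X \<subseteq> {1..k}" and Y: "Y \<in> indep (lpm P Q)" "Y \<subseteq> {Suc k..?n}" for X Y
  proof -
    obtain f where f: "inj_on f X" "\<forall>x\<in>X. f x \<in> {1..count_list P North} \<and>
        height P (x - 1) < f x \<and> f x \<le> height Q x"
      using X(1) unfolding indep_lpm_iff[OF assms(1)] by blast
    obtain g where g: "inj_on g Y" "\<forall>x\<in>Y. g x \<in> {1..count_list P North} \<and>
        height P (x - 1) < g x \<and> g x \<le> height Q x"
      using Y(1) unfolding indep_lpm_iff[OF assms(1)] by blast
    define h where "h = (\<lambda>x. if x \<le> k then f x else g x)"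
    have hX: "h x = f x" if "x \<in> X" for x using that X by (auto simp: h_def)
    have hY: "h x = g x" if "x \<in> Y" for x using that Y by (auto simp: h_def)
    have fle: "f x \<le> height P k" if "x \<in> X" for x
    proof -
      have "x \<le> k" using that X by auto
      then show ?thesis using f(2) that height_mono[of x k Q] assms(4) by fastforce
    qed
    have gle: "height P k < g x" if "x \<in> Y" for x
    proof -
      have "Suc k \<le> x" using that Y by (meson atLeastAtMost_iff subsetD)
      then have "k \<le> x - 1" by simp
      then show ?thesis using g(2) that height_mono[of k "x - 1" P] by fastforce
    qed
    have "inj_on h (X \<union> Y)"
      using f(1) g(1) hX hY fle gle unfolding inj_on_def by (metis Un_iff not_less)
    moreover have "\<forall>x\<in>X \<union> Y. h x \<in> {1..count_list P North} \<and> height P (x - 1) < h x \<and> h x \<le> height Q x"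
      using f(2) g(2) hX hY by auto
    moreover have "X \<union> Y \<subseteq> {1..?n}" using X Y assms(3) by auto
    ultimately show ?thesis unfolding indep_lpm_iff[OF assms(1)] by blast
  qed
  have indep: "indep (lpm P Q) = {X \<union> Y |X Y. X \<in> indep ?M1 \<and> Y \<in> indep ?M2}"
  proof (intro set_eqI iffI)
    fix X assume X: "X \<in> indep (lpm P Q)"
    then have "X \<subseteq> {1..?n}" by (simp add: indep_lpm_iff[OF assms(1)])
    then have "X = (X \<inter> {1..k}) \<union> (X \<inter> {Suc k..?n})" by auto
    moreover have "X \<inter> {1..k} \<in> indep ?M1" "X \<inter> {Suc k..?n} \<in> indep ?M2"
      using sub[OF X] by (auto simp: M_def)
    ultimately show "X \<in> {X \<union> Y |X Y. X \<in> indep ?M1 \<and> Y \<in> indep ?M2}" by blast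
  qed (auto simp: M_def intro!: join)
  have ground: "{1..?n} = {1..k} \<union> {Suc k..?n}" using assms by auto
  have "lpm P Q = direct_sum ?M1 ?M2"
  proof (rule matroid.equality)
    show "ground (lpm P Q) = ground (direct_sum ?M1 ?M2)"
      using ground by (simp add: direct_sum_def M_def)
    show "indep (lpm P Q) = indep (direct_sum ?M1 ?M2)"
      using indep by (simp add: direct_sum_def)
  qed simp
  moreover have "ground ?M1 \<noteq> {}" "ground ?M2 \<noteq> {}" "ground ?M1 \<inter> ground ?M2 = {}"
    "indep ?M1 \<subseteq> Pow (ground ?M1)" "indep ?M2 \<subseteq> Pow (ground ?M2)"
    using assms by (auto simp: M_def)
  ultimately show ?thesis unfolding connected_matroid_def by blast
qed

lemma indep_lpm_path:
  assumes PQ: "path_pair P Q" and R: "length R = length P"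
    and between: "\<And>k. k \<le> length P \<Longrightarrow> height P k \<le> height R k \<and> height R k \<le> height Q k"
  shows "{x \<in> {1..length P}. R ! (x - 1) = North} \<in> indep (lpm P Q)" (is "?X \<in> _")
proof -
  have step: "height R x = Suc (height R (x - 1))" if "x \<in> ?X" for x
    using that R height_Suc[of R "x - 1"] by auto
  have "inj_on (height R) ?X"
  proof (rule linorder_inj_onI)
    fix x y assume "x < y" "x \<in> ?X" "y \<in> ?X"
    moreover from this have "x \<le> y - 1" by linarith
    ultimately show "height R x \<noteq> height R y"
      using step[of y] height_mono[of x "y - 1" R] by simp
  qed auto
  moreover have "height R x \<in> {1..count_list P North} \<and> height P (x - 1) < height R x \<and>
      height R x \<le> height Q x" if "x \<in> ?X" for x
  proof -
    have x: "x \<le> length P" "1 \<le> x" using that by auto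
    then have "x - 1 \<le> length P" by linarith
    note between = between[OF x(1)] between[OF this]
    have "height Q x \<le> height Q (length P)" using x by (simp add: height_mono)
    then have "height Q x \<le> count_list P North" using PQ height_length[of P] by (simp add: path_pair_iff)
    then show ?thesis using step[OF that] between x by simp
  qed
  ultimately show ?thesis unfolding indep_lpm_iff[OF PQ] by blast
qed

lemma card_indep_lpm:
  assumes "path_pair P Q" "X \<in> indep (lpm P Q)"
  shows "card X \<le> count_list P North"
proof -
  obtain f where "inj_on f X" "f ` X \<subseteq> {1..count_list P North}"
    using assms(2) unfolding indep_lpm_iff[OF assms(1)] by blast
  then show ?thesis using card_inj_on_le[of f X "{1..count_list P North}"] by simp
qed

lemma path_pair_boundary: "path_pair (East # w @ [North]) (North # w @ [East])"
proof -
  have "height (East # w @ [North]) k \<le> height (North # w @ [East]) k" for k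
    by (cases k) (auto simp: height_lower height_upper min_def)
  then show ?thesis by (simp add: path_pair_def)
qed

lemma connected_boundary:
  fixes w :: lattice_path
  defines "P \<equiv> East # w @ [North]" and "Q \<equiv> North # w @ [East]"
  shows "connected_matroid (lpm P Q)"
  unfolding connected_matroid_def
proof (rule notI, elim exE conjE)
  fix M1 M2 :: "nat matroid"
  assume ne: "ground M1 \<noteq> {}" "ground M2 \<noteq> {}" and disj: "ground M1 \<inter> ground M2 = {}"
    and sub: "indep M1 \<subseteq> Pow (ground M1)" "indep M2 \<subseteq> Pow (ground M2)"
    and eq: "lpm P Q = direct_sum M1 M2"
  let ?n = "length P"
  have n: "?n = length w + 2" by (simp add: P_def)
  have PQ: "path_pair P Q" unfolding P_def Q_def by (rule path_pair_boundary)
  have ground: "{1..?n} = ground M1 \<union> ground M2"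
    using arg_cong[OF eq, of ground] by (simp add: direct_sum_def)
  have indep: "X \<in> indep (lpm P Q) \<longleftrightarrow> (\<exists>Y Z. X = Y \<union> Z \<and> Y \<in> indep M1 \<and> Z \<in> indep M2)" for X
    by (simp add: eq direct_sum_def)
  have split: "X \<inter> ground M1 \<in> indep M1 \<and> X \<inter> ground M2 \<in> indep M2" if X: "X \<in> indep (lpm P Q)" for X
  proof -
    obtain Y Z where YZ: "X = Y \<union> Z" "Y \<in> indep M1" "Z \<in> indep M2" using iffD1[OF indep X] by blast
    then have "Y \<subseteq> ground M1" "Z \<subseteq> ground M2" using sub by auto
    then have "X \<inter> ground M1 = Y" "X \<inter> ground M2 = Z" using YZ(1) disj by auto
    then show ?thesis using YZ by simp
  qed
  define nset where "nset = (\<lambda>R. {x \<in> {1..?n}. R ! (x - 1) = North})"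
  have card_nset: "card (nset R) = count_list R North" if "length R = ?n" for R
  proof -
    have "nset R = Suc ` {i. i < length R \<and> R ! i = North}"
    proof (intro set_eqI iffI)
      fix x assume "x \<in> nset R"
      then show "x \<in> Suc ` {i. i < length R \<and> R ! i = North}"
        using that by (intro image_eqI[of _ _ "x - 1"]) (auto simp: nset_def)
    qed (use that in \<open>auto simp: nset_def\<close>)
    then have "card (nset R) = length (filter ((=) North) R)"
      by (simp add: card_image length_filter_conv_card eq_commute)
    then show ?thesis by (simp add: count_list_eq_length_filter)
  qed
  have adjacent: "Suc i \<in> ground M1 \<longleftrightarrow> Suc (Suc i) \<in> ground M1" if "i \<le> length w" for i
  proof -
    define R1 where "R1 = take i w @ [North, East] @ drop i w"
    define R2 where "R2 = take i w @ [East, North] @ drop i w"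
    have len: "length R1 = ?n" "length R2 = ?n" using that by (simp_all add: R1_def R2_def P_def)
    have hw: "height w k \<le> height w (Suc k)" "height w (Suc k) \<le> Suc (height w k)" for k
      by (simp_all add: height_Suc)
    have h_split: "height w i + count_list (take m (drop i w)) North = height w (i + m)" for m
      by (simp add: height_def take_add)
    have h1: "height R1 k = (if k \<le> i then height w k else Suc (height w (max i (k - 2))))" for k
    proof (cases "k \<le> i")
      case True
      then show ?thesis using that by (simp add: R1_def height_def min_def)
    next
      case False
      then obtain m where m: "k = Suc (i + m)" using less_imp_Suc_add by (metis not_less)
      show ?thesis
        using that h_split[of "m - 1"] m by (cases m) (auto simp: R1_def height_def min_def)
    qed
    have h2: "height R2 k = (if k \<le> i then height w k else if k = Suc i then height w i
        else Suc (height w (k - 2)))" for k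
    proof (cases "k \<le> i")
      case True
      then show ?thesis using that by (simp add: R2_def height_def min_def)
    next
      case False
      then obtain m where m: "k = Suc (i + m)" using less_imp_Suc_add by (metis not_less)
      show ?thesis
        using that h_split[of "m - 1"] m by (cases m) (auto simp: R2_def height_def min_def)
    qed
    have hPQ: "height P (Suc k) = (if k \<le> length w then height w k else Suc (height w (length w)))"
      "height Q (Suc k) = Suc (height w (min k (length w)))" for k
      unfolding P_def Q_def by (rule height_lower height_upper)+
    have between: "height P k \<le> height R k \<and> height R k \<le> height Q k"
      if k: "k \<le> ?n" and R: "R = R1 \<or> R = R2" for k R
    proof (cases k)
      case 0
      then show ?thesis by simp
    next
      case (Suc l)
      have l: "l \<le> Suc (length w)" using k n Suc by simp
      consider "l < i" | "l = i" | "i < l" "l \<le> length w" | "l = Suc (length w)"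
        using l by linarith
      then show ?thesis
      proof cases
        case 1
        then have "height R k = height w (Suc l)" using R Suc by (auto simp: h1 h2)
        then show ?thesis using 1 that \<open>i \<le> length w\<close> hw[of l] Suc by (simp add: hPQ)
      next
        case 2
        then have "height R k = height w i \<or> height R k = Suc (height w i)"
          using R Suc by (auto simp: h1 h2)
        then show ?thesis using 2 \<open>i \<le> length w\<close> Suc by (auto simp: hPQ)
      next
        case 3
        then have "max i (l - 1) = l - 1" by linarith
        then have "height R k = Suc (height w (l - 1))" using R Suc 3 by (auto simp: h1 h2)
        then show ?thesis using 3 hw[of "l - 1"] Suc by (simp add: hPQ)
      next
        case 4
        then have "height R k = Suc (height w (length w))"
          using R Suc \<open>i \<le> length w\<close> by (auto simp: h1 h2 max_def)
        then show ?thesis using 4 Suc by (simp add: hPQ)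
      qed
    qed
    have ind: "nset R1 \<in> indep (lpm P Q)" "nset R2 \<in> indep (lpm P Q)"
      unfolding nset_def by (rule indep_lpm_path[OF PQ]; use len between in blast)+
    define B where "B = nset R1 - {Suc i}"
    have nth: "R1 ! i = North" "R1 ! Suc i = East" "R2 ! i = East" "R2 ! Suc i = North"
      using that by (simp_all add: R1_def R2_def nth_append min_def)
    have nth_eq: "R1 ! j = R2 ! j" if "j \<noteq> i" "j \<noteq> Suc i" for j
    proof (cases "j < i")
      case True
      then show ?thesis using \<open>i \<le> length w\<close> by (simp add: R1_def R2_def nth_append)
    next
      case False
      then have "j - i = Suc (Suc (j - i - 2))" using that by simp
      then show ?thesis using False \<open>i \<le> length w\<close>
        by (simp add: R1_def R2_def nth_append min_def nth_Cons split: nat.split)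
    qed
    have N1: "nset R1 = insert (Suc i) B" using that nth n by (auto simp: B_def nset_def)
    have N2: "nset R2 = insert (Suc (Suc i)) B"
    proof (rule set_eqI)
      fix x
      consider "x = Suc i" | "x = Suc (Suc i)" | "x = 0"
        | "x \<noteq> 0" "x - 1 \<noteq> i" "x - 1 \<noteq> Suc i" by linarith
      then show "x \<in> nset R2 \<longleftrightarrow> x \<in> insert (Suc (Suc i)) B"
        by cases (use that nth n nth_eq[of "x - 1"] in \<open>auto simp: B_def nset_def\<close>)
    qed
    have B: "Suc i \<notin> B" "Suc (Suc i) \<notin> B" "finite B" using nth by (auto simp: B_def nset_def)
    have big: "insert (Suc i) (insert (Suc (Suc i)) B) \<notin> indep (lpm P Q)"
    proof
      assume "insert (Suc i) (insert (Suc (Suc i)) B) \<in> indep (lpm P Q)"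
      then have "card (insert (Suc i) (insert (Suc (Suc i)) B)) \<le> count_list P North"
        by (rule card_indep_lpm[OF PQ])
      moreover have "Suc (card B) = count_list R1 North"
        using card_nset[OF len(1)] N1 B by simp
      moreover have "count_list R1 North = count_list P North"
        using count_list_append[of "take i w" "drop i w" North] by (simp add: R1_def P_def)
      ultimately show False using B by simp
    qed
    have i_ground: "Suc i \<in> ground M1 \<union> ground M2" "Suc (Suc i) \<in> ground M1 \<union> ground M2"
      unfolding ground[symmetric] using that n by auto
    have sub_ground: "B \<subseteq> ground M1 \<union> ground M2"
      unfolding ground[symmetric] by (auto simp: B_def nset_def)
    note s1 = split[OF ind(1), unfolded N1] and s2 = split[OF ind(2), unfolded N2]
    show ?thesis
    proof (rule ccontr)
      assume "\<not> ?thesis"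
      then consider "Suc i \<in> ground M1" "Suc (Suc i) \<in> ground M2" "Suc i \<notin> ground M2" "Suc (Suc i) \<notin> ground M1"
        | "Suc i \<in> ground M2" "Suc (Suc i) \<in> ground M1" "Suc i \<notin> ground M1" "Suc (Suc i) \<notin> ground M2"
        using i_ground disj by blast
      then show False
      proof cases
        case 1
        then have "insert (Suc i) (insert (Suc (Suc i)) B) =
            (insert (Suc i) B \<inter> ground M1) \<union> (insert (Suc (Suc i)) B \<inter> ground M2)"
          using sub_ground by blast
        then show False using big indep s1 s2 by blast
      next
        case 2
        then have "insert (Suc i) (insert (Suc (Suc i)) B) =
            (insert (Suc (Suc i)) B \<inter> ground M1) \<union> (insert (Suc i) B \<inter> ground M2)"
          using sub_ground by blast
        then show False using big indep s1 s2 by blast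
      qed
    qed
  qed
  have all: "Suc i \<in> ground M1 \<longleftrightarrow> 1 \<in> ground M1" if "i \<le> Suc (length w)" for i
    using that by (induction i) (simp_all add: adjacent[symmetric])
  have const: "x \<in> ground M1 \<longleftrightarrow> 1 \<in> ground M1" if "x \<in> {1..?n}" for x
  proof -
    have "Suc (x - 1) = x" "x - 1 \<le> Suc (length w)" using that n by auto
    then show ?thesis using all[of "x - 1"] by simp
  qed
  obtain x y where "x \<in> ground M1" "y \<in> ground M2" using ne by blast
  moreover from this have "x \<in> {1..?n}" "y \<in> {1..?n}" using ground by simp_all
  ultimately show False using const[of x] const[of y] disj by auto
qed

theorem snake_paths_iff:
  assumes "a \<noteq> []" "\<forall>b\<in>set a. 1 \<le> b"
  shows "is_snake P Q \<and> diagram P Q = snake_squares a \<longleftrightarrow> P = lower_path a \<and> Q = upper_path a"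
proof (intro iffI conjI)
  let ?w = "walk East a"
  assume asm: "is_snake P Q \<and> diagram P Q = snake_squares a"
  then have PQ: "path_pair P Q" and conn: "connected_matroid (lpm P Q)" by (simp_all add: is_snake_def)
  have len: "length Q = length P" using PQ by (simp add: path_pair_iff)
  have squares: "i + j + 2 \<le> length P \<and> height P (Suc (i + j)) \<le> j \<and> j < height Q (Suc (i + j)) \<longleftrightarrow>
      i + j \<le> length ?w \<and> j = height ?w (i + j)" for i j
    using asm mem_diagram_iff[OF PQ, of i j] mem_snake_squares_iff[OF assms, of i j] by simp
  have diag: "k + 2 \<le> length P \<and> height P (Suc k) \<le> j \<and> j < height Q (Suc k) \<longleftrightarrow>
      k \<le> length ?w \<and> j = height ?w k" if "j \<le> k" for j k
    using squares[of "k - j" j] that by simp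
  have ge: "length ?w + 2 \<le> length P"
    using diag[OF height_le, of "length ?w" ?w] by simp
  have "length P = length ?w + 2"
  proof (rule ccontr)
    assume "length P \<noteq> length ?w + 2"
    with ge have less: "length ?w + 2 < length P" by simp
    let ?k = "Suc (length ?w)"
    have "height P (Suc ?k) = height Q (Suc ?k)"
    proof (rule ccontr)
      assume "height P (Suc ?k) \<noteq> height Q (Suc ?k)"
      moreover have "height P (Suc ?k) \<le> height Q (Suc ?k)" using PQ less by (simp add: path_pair_iff)
      ultimately have lt: "height P (Suc ?k) < height Q (Suc ?k)" by simp
      then have "height P (Suc ?k) \<le> ?k" using height_le[of Q "Suc ?k"] by simp
      from diag[OF this] lt less show False by simp
    qed
    then show False using not_connected_lpm[OF PQ, of "Suc ?k"] conn less by simp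
  qed
  note n = this
  have hP: "height P (Suc k) = height ?w k" and hQ: "height Q (Suc k) = Suc (height ?w k)"
    if "k \<le> length ?w" for k
  proof -
    have mem: "height P (Suc k) \<le> height ?w k" "height ?w k < height Q (Suc k)"
      using diag[OF height_le, of k ?w] that by auto
    have "height P (Suc k) \<le> k" "height Q (Suc k) - 1 \<le> k"
      using mem height_le[of Q "Suc k"] height_le[of ?w k] by linarith+
    from diag[OF this(1)] diag[OF this(2)] show "height P (Suc k) = height ?w k"
      "height Q (Suc k) = Suc (height ?w k)" using mem that n by auto
  qed
  have "height P (length P) = height Q (length P)" using PQ unfolding path_pair_iff by blast
  moreover have "height P (length P) \<le> Suc (height ?w (length ?w))"
    using height_Suc[of P "Suc (length ?w)"] hP[of "length ?w"] n by simp
  moreover have "Suc (height ?w (length ?w)) \<le> height Q (length P)"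
    using height_Suc[of Q "Suc (length ?w)"] hQ[of "length ?w"] n by simp
  ultimately have last: "height P (Suc (Suc (length ?w))) = Suc (height ?w (length ?w))"
    "height Q (Suc (Suc (length ?w))) = Suc (height ?w (length ?w))" using n by simp_all
  show "P = lower_path a" unfolding lower_path_def
  proof (rule height_inject)
    fix k assume "k \<le> length P"
    then consider "k = 0" | l where "k = Suc l" "l \<le> length ?w" | "k = Suc (Suc (length ?w))"
      using n by (cases k) (auto simp: le_Suc_eq)
    then show "height P k = height (East # ?w @ [North]) k"
      by cases (simp_all add: hP last height_lower)
  qed (simp add: n)
  show "Q = upper_path a" unfolding upper_path_def
  proof (rule height_inject)
    fix k assume "k \<le> length Q"
    then consider "k = 0" | l where "k = Suc l" "l \<le> length ?w" | "k = Suc (Suc (length ?w))"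
      using n len by (cases k) (auto simp: le_Suc_eq)
    then show "height Q k = height (North # ?w @ [East]) k"
      by cases (simp_all add: hQ last height_upper min_def)
  qed (simp add: n len)
next
  let ?w = "walk East a"
  assume "P = lower_path a \<and> Q = upper_path a"
  then have P: "P = East # ?w @ [North]" and Q: "Q = North # ?w @ [East]"
    by (simp_all add: lower_path_def upper_path_def)
  have PQ: "path_pair P Q" unfolding P Q by (rule path_pair_boundary)
  have mem: "(i, j) \<in> diagram P Q \<longleftrightarrow> i + j \<le> length ?w \<and> j = height ?w (i + j)" for i j
    unfolding mem_diagram_iff[OF PQ] unfolding P Q height_lower height_upper by auto
  show "diagram P Q = snake_squares a"
    using mem mem_snake_squares_iff[OF assms] by auto
  have "interior_points P Q = {}"
    unfolding interior_points_def by (auto simp: mem)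
  then show "is_snake P Q"
    using PQ connected_boundary[of ?w] by (simp add: is_snake_def P Q)
qed

corollary snake_eq_lpm:
  assumes "a \<noteq> []" "\<forall>b\<in>set a. 1 \<le> b"
  shows "snake a = lpm (lower_path a) (upper_path a)"
  unfolding snake_def by (rule the_equality) (metis snake_paths_iff[OF assms])+

end

theory Submission
  imports Defs
begin

text \<open>
  Every element of the lattice path matroid of a snake lies in one or two consecutive sets of the
  presentation: in two if it comes from a North step of the walk through the squares, in one
  otherwise. Read the sets as the vertices of a path, the elements in two sets as the edges of this
  path, and join the elements in one set to an additional hub; this graph is the multi-fan. A system
  of distinct representatives assigns to each edge one of its ends other than the hub, injectively.
  A cycle has as many edges as vertices, so such an assignment excludes cycles through the hub, and
  the path has no cycles. Conversely, if no two spokes of an edge set are joined by path edges of the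
  set, then orienting each component away from its spoke gives a system of distinct representatives.
\<close>

section \<open>Systems of distinct representatives along a path\<close>

text \<open>A system of distinct representatives with the sets counted from 0: an
  \<open>East\<close> step allows one level, a \<open>North\<close> step two consecutive ones.
  Levels later index the vertices of the path.\<close>

definition level_choice :: "step list \<Rightarrow> nat set \<Rightarrow> (nat \<Rightarrow> nat) \<Rightarrow> bool" where
  "level_choice t Y g \<longleftrightarrow> inj_on g Y \<and> (\<forall>p\<in>Y. height t p \<le> g p \<and> g p \<le> height t (Suc p))"

text \<open>The list \<open>East # w @ [East]\<close> differs from the lower boundary only in the
  last step and from the upper one only in the first, so one height function describes both
  bounds.\<close>

lemma height_ends:
  assumes "k \<le> Suc (length w)"
  shows "height (East # w @ [North]) k = height (East # w @ [East]) k"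
    and "height (North # w @ [East]) (Suc k) = Suc (height (East # w @ [East]) (Suc k))"
  using assms by (cases k; force simp: height_def)+

text \<open>Element \<open>Suc p\<close> lies in the sets above \<open>height t p\<close> up to
  \<open>Suc (height t (Suc p))\<close>; lowering each representative by 1 gives a level
  choice.\<close>

lemma indep_boundary_iff:
  fixes w :: lattice_path
  defines "t \<equiv> East # w @ [East]"
  assumes "Y \<subseteq> {..<length t}"
  shows "Suc ` Y \<in> indep (lpm (East # w @ [North]) (North # w @ [East])) \<longleftrightarrow> (\<exists>g. level_choice t Y g)"
    (is "Suc ` Y \<in> indep (lpm ?P ?Q) \<longleftrightarrow> _")
proof -
  have le: "p \<le> Suc (length w)" if "p \<in> Y" for p
    using assms(2) that by (auto simp: t_def)
  have hP: "height ?P p = height t p" and hQ: "height ?Q (Suc p) = Suc (height t (Suc p))"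
    if "p \<in> Y" for p
    using height_ends[OF le[OF that]] by (simp_all add: t_def)
  \<comment> \<open>The lower boundary has one \<open>North\<close> step more than \<open>t\<close>,
    so the shifted levels are valid set indices.\<close>
  have top: "height t (Suc p) < count_list ?P North" if "p \<in> Y" for p
  proof -
    have "height t (Suc p) \<le> height t (length t)"
      using le[OF that] by (intro height_mono) (simp add: t_def)
    also have "\<dots> < count_list ?P North" by (simp add: t_def height_def)
    finally show ?thesis .
  qed
  have sub: "Suc ` Y \<subseteq> {1..length ?P}" using le by auto
  show ?thesis unfolding indep_lpm_iff[OF path_pair_boundary]
  proof (intro iffI conjI sub)
    assume "Suc ` Y \<subseteq> {1..length ?P} \<and> (\<exists>f. inj_on f (Suc ` Y) \<and> (\<forall>x\<in>Suc ` Y.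
      f x \<in> {1..count_list ?P North} \<and> height ?P (x - 1) < f x \<and> f x \<le> height ?Q x))"
    then obtain f where f: "inj_on f (Suc ` Y)"
      "\<And>p. p \<in> Y \<Longrightarrow> height t p < f (Suc p) \<and> f (Suc p) \<le> Suc (height t (Suc p))"
      using hP hQ by force
    have "inj_on (\<lambda>p. f (Suc p) - 1) Y"
    proof (rule inj_onI)
      fix p q assume "p \<in> Y" "q \<in> Y" "f (Suc p) - 1 = f (Suc q) - 1"
      moreover from this have "f (Suc p) = f (Suc q)" using f(2)[of p] f(2)[of q] by linarith
      ultimately show "p = q" using f(1) by (auto dest: inj_onD)
    qed
    then have "level_choice t Y (\<lambda>p. f (Suc p) - 1)"
      using f(2) by (force simp: level_choice_def)
    then show "\<exists>g. level_choice t Y g" by blast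
  next
    assume "\<exists>g. level_choice t Y g"
    then obtain g where g: "inj_on g Y" "\<And>p. p \<in> Y \<Longrightarrow> height t p \<le> g p \<and> g p \<le> height t (Suc p)"
      by (auto simp: level_choice_def)
    have "inj_on (\<lambda>x. Suc (g (x - 1))) (Suc ` Y)"
      using g(1) by (auto simp: inj_on_def)
    moreover have "Suc (g p) \<in> {1..count_list ?P North} \<and> height ?P p < Suc (g p) \<and>
        Suc (g p) \<le> height ?Q (Suc p)" if "p \<in> Y" for p
      using g(2)[OF that] top[OF that] hP[OF that] hQ[OF that] by auto
    ultimately show "\<exists>f. inj_on f (Suc ` Y) \<and> (\<forall>x\<in>Suc ` Y.
      f x \<in> {1..count_list ?P North} \<and> height ?P (x - 1) < f x \<and> f x \<le> height ?Q x)"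
      by (intro exI[of _ "\<lambda>x. Suc (g (x - 1))"]) auto
  qed
qed

lemma height_Suc_step:
  assumes "p < length t"
  shows "t ! p = East \<Longrightarrow> height t (Suc p) = height t p"
    and "t ! p = North \<Longrightarrow> height t (Suc p) = Suc (height t p)"
  using assms by (simp_all add: height_Suc)

lemma height_less_of_North:
  assumes "p < q" "p < length t" "t ! p = North"
  shows "height t p < height t q"
  using height_mono[of "Suc p" q t] height_Suc_step(2)[of p t] assms by simp

lemma no_North_between:
  assumes "height t (Suc p) = height t q" "p < z" "z < q" "q \<le> length t"
  shows "t ! z \<noteq> North"
  using height_less_of_North[of z q t] height_mono[of "Suc p" z t] assms by auto

text \<open>Discrete intermediate values: the height grows by at most one per step, so it leaves
  level \<open>l\<close> through a \<open>North\<close> step.\<close>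

lemma exists_North_at_level:
  assumes "height t p \<le> l" "l < height t q"
  shows "\<exists>z. p \<le> z \<and> z < q \<and> z < length t \<and> t ! z = North \<and> height t z = l"
  using assms
proof (induction q)
  case (Suc q)
  show ?case
  proof (cases "l < height t q")
    case True
    then show ?thesis using Suc by force
  next
    case False
    then have q: "q < length t" "t ! q = North" "height t q = l"
      using Suc.prems by (auto simp: height_Suc split: if_splits)
    moreover have "p \<le> q"
      using height_mono[of "Suc q" p t] Suc.prems by (meson leD not_less_eq_eq order_trans)
    ultimately show ?thesis by blast
  qed
qed simp

section \<open>Orientation away from the spokes\<close>

text \<open>Two spokes that path edges of \<open>Y\<close> close to a cycle through the hub; with no
  \<open>North\<close> step between them they are parallel.\<close>

definition joined_spokes :: "step list \<Rightarrow> nat set \<Rightarrow> nat \<Rightarrow> nat \<Rightarrow> bool" where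
  "joined_spokes t Y p q \<longleftrightarrow> p < q \<and> p \<in> Y \<and> q \<in> Y \<and> t ! p = East \<and> t ! q = East \<and>
     (\<forall>z. p < z \<and> z < q \<and> t ! z = North \<longrightarrow> z \<in> Y)"

text \<open>A component has at most one spoke. A path edge takes its upper end if that spoke lies
  below it, and its lower end otherwise.\<close>

lemma level_choice_exists:
  assumes Y: "Y \<subseteq> {..<length t}" and free: "\<And>p q. \<not> joined_spokes t Y p q"
  shows "\<exists>g. level_choice t Y g"
proof -
  \<comment> \<open>\<open>below p\<close> says that path edges of \<open>Y\<close> connect some
    spoke of \<open>Y\<close> to the lower end of step \<open>p\<close>.\<close>
  define below where "below = (\<lambda>p. \<exists>x<p. x \<in> Y \<and> t ! x = East \<and>
      (\<forall>z. x < z \<and> z < p \<and> t ! z = North \<longrightarrow> z \<in> Y))"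
  define g where "g = (\<lambda>p. if t ! p = North \<and> below p then height t (Suc p) else height t p)"
  have len: "p < length t" if "p \<in> Y" for p using Y that by auto
  have bounds: "height t p \<le> g p \<and> g p \<le> height t (Suc p)" for p
    using height_mono[of p "Suc p" t] by (auto simp: g_def)
  have not_below: "\<not> below q" if "q \<in> Y" "t ! q = East" for q
    using free that unfolding below_def joined_spokes_def by blast
  have "inj_on g Y"
  proof (rule linorder_inj_onI)
    fix p q assume pq: "p < q" "p \<in> Y" "q \<in> Y"
    show "g p \<noteq> g q"
    proof
      assume eq: "g p = g q"
      have mono: "height t (Suc p) \<le> height t q" using pq by (simp add: height_mono)
      \<comment> \<open>A common value forces \<open>p\<close> to take its upper and
        \<open>q\<close> its lower level, and these to coincide.\<close>
      then have gp: "g p = height t (Suc p)" and gq: "g q = height t q"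
        and level: "height t (Suc p) = height t q"
        using bounds[of p] bounds[of q] eq by linarith+
      have gap: "t ! z \<noteq> North" if "p < z" "z < q" for z
        using no_North_between[OF level that] len[OF pq(3)] by simp
      \<comment> \<open>The spoke is \<open>p\<close> itself or the one below \<open>p\<close>,
        since no path edge lies strictly between \<open>p\<close> and \<open>q\<close>.\<close>
      have "below q"
      proof (cases "t ! p")
        case East
        then show ?thesis using pq gap unfolding below_def by blast
      next
        case North
        then have "below p" using gp height_Suc_step(2)[OF len[OF pq(2)]]
          by (auto simp: g_def split: if_splits)
        then obtain x where x: "x < p" "x \<in> Y" "t ! x = East"
          "\<And>z. x < z \<Longrightarrow> z < p \<Longrightarrow> t ! z = North \<Longrightarrow> z \<in> Y" unfolding below_def by blast
        have "z \<in> Y" if "x < z" "z < q" "t ! z = North" for z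
          using x(4)[of z] gap[of z] that pq(2) by (cases z p rule: linorder_cases) auto
        then show ?thesis using x pq(1) unfolding below_def by (meson order_less_trans)
      qed
      moreover from this have "t ! q = North" using not_below pq(3) by (metis step.exhaust)
      ultimately show False
        using gq height_Suc_step(2)[OF len[OF pq(3)]] by (simp add: g_def)
    qed
  qed auto
  then show ?thesis using bounds unfolding level_choice_def by blast
qed


section \<open>Paths with a hub\<close>

text \<open>
  The edges \<open>es\<close> are listed along the path with vertices \<open>R\<close>: a step \<open>East\<close> is an edge from the
  current vertex to the hub, a step \<open>North\<close> is the path edge to the next vertex.
\<close>

inductive hub_path :: "('e \<Rightarrow> 'v set) \<Rightarrow> 'v \<Rightarrow> step list \<Rightarrow> 'e list \<Rightarrow> 'v list \<Rightarrow> bool"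
  for g :: "'e \<Rightarrow> 'v set" and h :: 'v where
  hub_path_end: "hub_path g h [] [] [r]"
| hub_path_East: "hub_path g h t es (r # R) \<Longrightarrow> g e = {h, r} \<Longrightarrow> hub_path g h (East # t) (e # es) (r # R)"
| hub_path_North: "hub_path g h t es (r' # R) \<Longrightarrow> g e = {r, r'} \<Longrightarrow>
    hub_path g h (North # t) (e # es) (r # r' # R)"

lemma hub_path_lengths:
  "hub_path g h t es R \<Longrightarrow> length es = length t \<and> length R = Suc (height t (length t))"
  by (induction rule: hub_path.induct) (auto simp: height_def)

text \<open>The height counts the path edges passed, hence it is the index of the current vertex in
  \<open>R\<close>.\<close>

lemma hub_path_ends:
  assumes "hub_path g h t es R" "p < length t"
  shows "g (es ! p) = (if t ! p = East then {h, R ! height t p}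
                       else {R ! height t p, R ! Suc (height t p)})"
  using assms
proof (induction arbitrary: p rule: hub_path.induct)
  case (hub_path_East t es r R e)
  then show ?case by (cases p) (auto simp: height_def)
next
  case (hub_path_North t es r' R e r)
  then show ?case by (cases p) (auto simp: height_def)
qed simp

section \<open>Cycles in a graph with a hub path\<close>

lemma cycle_ends_subset:
  assumes "is_cycle G vs es" "e \<in> set es"
  shows "ends G e \<subseteq> set vs"
proof -
  obtain i where i: "i < length es" "es ! i = e" using assms(2) by (auto simp: in_set_conv_nth)
  then have "Suc i mod length es < length vs" "i < length vs"
    using assms(1) by (auto simp: is_cycle_def intro!: mod_less_divisor)
  then show ?thesis using assms(1) i by (auto simp: is_cycle_def)
qed

text \<open>A cycle has equally many edges and vertices, so an injective choice of ends exhausts its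
  vertices.\<close>

lemma cycle_ends_representatives:
  assumes "is_cycle G vs es" "inj_on s (set es)" "\<And>e. e \<in> set es \<Longrightarrow> s e \<in> ends G e"
  shows "s ` set es = set vs"
proof (rule card_subset_eq)
  show "s ` set es \<subseteq> set vs" using cycle_ends_subset[OF assms(1)] assms(3) by blast
  show "card (s ` set es) = card (set vs)"
    using assms(1,2) by (simp add: card_image is_cycle_def distinct_card)
qed simp

locale hub_path_graph =
  fixes G :: "('v, 'e) multigraph" and h :: 'v and t :: "step list" and es :: "'e list" and R :: "'v list"
  assumes path: "hub_path (ends G) h t es R"
    and distinct_edges: "distinct es" and edges_eq: "edges G = set es"
    and distinct_verts: "distinct (h # R)" and verts_sub: "set (h # R) \<subseteq> verts G"
begin

lemma level_less: "p \<le> length t \<Longrightarrow> height t p < length R"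
  using hub_path_lengths[OF path] height_mono[of p "length t" t] by simp

text \<open>The chosen representatives are never the hub, so no cycle passes through it; a cycle
  avoiding the hub would lie in the path.\<close>

lemma no_cycle_if_level_choice:
  assumes Y: "Y \<subseteq> {..<length t}" and g: "level_choice t Y g"
  shows "\<not> (is_cycle G vs cs \<and> set cs \<subseteq> (!) es ` Y)"
proof
  assume "is_cycle G vs cs \<and> set cs \<subseteq> (!) es ` Y"
  then have cyc: "is_cycle G vs cs" and sub: "set cs \<subseteq> (!) es ` Y" by auto
  define pos where "pos = the_inv_into {..<length t} ((!) es)"
  have inj: "inj_on ((!) es) {..<length t}"
    using distinct_edges hub_path_lengths[OF path] by (intro inj_on_nth) auto
  have pos: "pos e \<in> Y \<and> pos e < length t \<and> es ! pos e = e" if e: "e \<in> set cs" for e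
  proof -
    obtain p where "p \<in> Y" "e = es ! p" using e sub by blast
    then show ?thesis using the_inv_into_f_f[OF inj, of p] Y by (auto simp: pos_def)
  qed
  have pos_inj: "inj_on pos (set cs)" using pos by (metis inj_onI)
  have R_inj: "inj_on ((!) R) {..<length R}" using distinct_verts by (intro inj_on_nth) auto
  have ends: "ends G e = (if t ! pos e = East then {h, R ! height t (pos e)}
      else {R ! height t (pos e), R ! Suc (height t (pos e))})" if "e \<in> set cs" for e
    using hub_path_ends[OF path, of "pos e"] pos[OF that] by simp
  show False
  proof (cases "h \<in> set vs")
    case True
    have bounds: "height t (pos e) \<le> g (pos e)" "g (pos e) \<le> height t (Suc (pos e))" if "e \<in> set cs" for e
      using g pos[OF that] by (auto simp: level_choice_def)
    have less: "g (pos e) < length R" if "e \<in> set cs" for e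
      using bounds(2)[OF that] level_less[of "Suc (pos e)"] pos[OF that] by simp
    have "(\<lambda>e. R ! g (pos e)) ` set cs = set vs"
    proof (rule cycle_ends_representatives[OF cyc])
      have "inj_on (g \<circ> pos) (set cs)"
        using g pos by (intro comp_inj_on[OF pos_inj]) (auto simp: level_choice_def intro: inj_on_subset)
      then have "inj_on ((!) R \<circ> (g \<circ> pos)) (set cs)"
        using less by (rule_tac comp_inj_on) (auto intro: inj_on_subset[OF R_inj])
      then show "inj_on (\<lambda>e. R ! g (pos e)) (set cs)" by (simp add: comp_def)
    next
      fix e assume e: "e \<in> set cs"
      show "R ! g (pos e) \<in> ends G e"
      proof (cases "t ! pos e")
        case East
        then have "g (pos e) = height t (pos e)"
          using bounds[OF e] height_Suc_step(1)[of "pos e" t] pos[OF e] by simp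
        then show ?thesis using ends[OF e] by auto
      next
        case North
        then have "g (pos e) = height t (pos e) \<or> g (pos e) = Suc (height t (pos e))"
          using bounds[OF e] height_Suc_step(2)[of "pos e" t] pos[OF e] by auto
        then show ?thesis unfolding ends[OF e] North by (elim disjE) simp_all
      qed
    qed
    then obtain e where "e \<in> set cs" "h = R ! g (pos e)" using True by blast
    then have "h \<in> set R" using less by simp
    then show False using distinct_verts by simp
  next
    case False
    have North: "t ! pos e = North" if "e \<in> set cs" for e
      using cycle_ends_subset[OF cyc that] ends[OF that] False by (metis insert_subset step.exhaust)
    have less: "Suc (height t (pos e)) < length R" if "e \<in> set cs" for e
      using level_less[of "Suc (pos e)"] height_Suc_step(2)[of "pos e" t] pos[OF that] North[OF that]
      by simp
    \<comment> \<open>All edges are path edges now; their lower ends are distinct and serve as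
      representatives.\<close>
    have "(\<lambda>e. R ! height t (pos e)) ` set cs = set vs"
    proof (rule cycle_ends_representatives[OF cyc])
      show "inj_on (\<lambda>e. R ! height t (pos e)) (set cs)"
      proof (rule inj_onI)
        fix e e' assume e: "e \<in> set cs" "e' \<in> set cs" "R ! height t (pos e) = R ! height t (pos e')"
        then have "height t (pos e) = height t (pos e')"
          using less distinct_verts by (metis Suc_lessD distinct.simps(2) nth_eq_iff_index_eq)
        then have "pos e = pos e'"
          using height_less_of_North[of "pos e" "pos e'" t] height_less_of_North[of "pos e'" "pos e" t]
            North pos e(1,2) by (metis nat_neq_iff)
        then show "e = e'" using pos_inj e by (auto dest: inj_onD)
      qed
    qed (use ends North in auto)
    \<comment> \<open>the highest vertex of the cycle cannot be the lower end of one of its edges\<close>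
    then have reps: "set vs = (\<lambda>e. R ! height t (pos e)) ` set cs" by simp
    define l where "l = Max ((\<lambda>e. height t (pos e)) ` set cs)"
    have "cs \<noteq> []" using cyc by (simp add: is_cycle_def)
    then have "l \<in> (\<lambda>e. height t (pos e)) ` set cs" unfolding l_def by (intro Max_in) auto
    then obtain e where e: "e \<in> set cs" "l = height t (pos e)" by blast
    then have "R ! Suc l \<in> set vs"
      using cycle_ends_subset[OF cyc e(1)] ends[OF e(1)] North[OF e(1)] by auto
    then obtain e' where e': "e' \<in> set cs" "R ! Suc l = R ! height t (pos e')" using reps by auto
    then have "Suc l = height t (pos e')"
      using less[OF e(1)] less[OF e'(1)] e(2) distinct_verts by (simp add: nth_eq_iff_index_eq)
    moreover have "height t (pos e') \<le> l" unfolding l_def using e' by (intro Max_ge) auto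
    ultimately show False by simp
  qed
qed

text \<open>The cycle leaves the hub by \<open>p\<close>, climbs one path edge per level and returns
  by \<open>q\<close>; other spokes of \<open>Y\<close> between them are skipped.\<close>

lemma cycle_if_joined_spokes:
  assumes Y: "Y \<subseteq> {..<length t}" and join: "joined_spokes t Y p q"
  shows "\<exists>vs cs. is_cycle G vs cs \<and> set cs \<subseteq> (!) es ` Y"
proof -
  have pq: "p < q" "p \<in> Y" "q \<in> Y" "p < length t" "q < length t" "t ! p = East" "t ! q = East"
    using join Y by (auto simp: joined_spokes_def)
  \<comment> \<open>The number of path edges to climb; \<open>m = 0\<close> yields two parallel
    spokes, a cycle of length 2.\<close>
  define m where "m = height t q - height t p"
  define l where "l = height t p"
  have q_level: "height t q = l + m" using height_mono[of p q t] pq by (simp add: m_def l_def)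
  have "\<exists>z. z \<in> Y \<and> t ! z = North \<and> height t z = l + j" if j: "j < m" for j
  proof -
    obtain z where z: "p \<le> z" "z < q" "t ! z = North" "height t z = l + j"
      using exists_North_at_level[of t p "l + j" q] j q_level unfolding l_def by auto
    moreover have "p \<noteq> z" using pq z by auto
    ultimately have "z \<in> Y" using join by (simp add: joined_spokes_def)
    then show ?thesis using z by blast
  qed
  then obtain z where z: "\<And>j. j < m \<Longrightarrow> z j \<in> Y \<and> t ! z j = North \<and> height t (z j) = l + j"
    by metis
  define ps where "ps = p # map z [0..<m] @ [q]"
  define vs where "vs = h # map (\<lambda>j. R ! (l + j)) [0..<Suc m]"
  have ps_Y: "set ps \<subseteq> Y" using pq z by (auto simp: ps_def)
  have "inj_on z {0..<m}"
    by (rule inj_onI) (metis z add_left_cancel atLeastLessThan_iff)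
  then have "distinct ps" using pq z by (auto simp: ps_def distinct_map)
  have len: "length ps = Suc (Suc m)" "length vs = Suc (Suc m)" by (simp_all add: ps_def vs_def)
  have R_len: "l + j < length R" if "j \<le> m" for j
    using level_less[of q] q_level pq that by simp
  have "is_cycle G vs (map ((!) es) ps)"
    unfolding is_cycle_def
  proof (intro conjI allI impI)
    show "distinct vs"
    proof -
      have "inj_on (\<lambda>j. R ! (l + j)) {0..<Suc m}"
        using R_len distinct_verts by (auto simp: inj_on_def nth_eq_iff_index_eq)
      moreover have "h \<notin> (\<lambda>j. R ! (l + j)) ` {0..<Suc m}"
        using distinct_verts R_len by auto
      ultimately show ?thesis by (simp add: vs_def distinct_map del: upt_Suc)
    qed
    show "distinct (map ((!) es) ps)"
    proof -
      have "inj_on ((!) es) (set ps)"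
        using ps_Y Y distinct_edges hub_path_lengths[OF path] by (intro inj_on_nth) auto
      then show ?thesis using \<open>distinct ps\<close> by (simp add: distinct_map)
    qed
    show "set vs \<subseteq> verts G"
    proof -
      have "R ! (l + j) \<in> set R" if "j \<le> m" for j using R_len[OF that] by simp
      then show ?thesis using verts_sub by (auto simp: vs_def simp del: upt_Suc)
    qed
    show "set (map ((!) es) ps) \<subseteq> edges G"
    proof -
      have "es ! x \<in> set es" if "x \<in> set ps" for x
        using that ps_Y Y hub_path_lengths[OF path] by (intro nth_mem) auto
      then show ?thesis by (auto simp: edges_eq)
    qed
    fix i assume "i < length (map ((!) es) ps)"
    then have i: "i < length ps" by simp
    have ends: "ends G (map ((!) es) ps ! i) = (if t ! (ps ! i) = East then {h, R ! height t (ps ! i)}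
                       else {R ! height t (ps ! i), R ! Suc (height t (ps ! i))})"
      using hub_path_ends[OF path, of "ps ! i"] i subsetD[OF subset_trans[OF ps_Y Y] nth_mem[OF i]] by simp
    have vs_nth: "vs ! Suc j = R ! (l + j)" if "j \<le> m" for j
      using that by (simp add: vs_def del: upt_Suc)
    \<comment> \<open>The spoke from the hub, a path edge, or the spoke back to the hub, where the
      vertex index wraps around to 0.\<close>
    consider "i = 0" | j where "i = Suc j" "j < m" | "i = Suc m"
      using i len less_Suc_eq_0_disj less_Suc_eq by metis
    then show "ends G (map ((!) es) ps ! i) =
        {vs ! i, vs ! (Suc i mod length (map ((!) es) ps))}"
    proof cases
      case 1
      then show ?thesis using ends vs_nth[of 0] pq len by (simp add: ps_def vs_def l_def)
    next
      case 2
      then have "ps ! i = z j" by (simp add: ps_def nth_append)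
      then show ?thesis using ends 2 z[OF 2(2)] vs_nth[of j] vs_nth[of "Suc j"] len by simp
    next
      case 3
      then have "ps ! i = q" by (simp add: ps_def nth_append)
      then show ?thesis using ends 3 pq vs_nth[of m] len q_level by (auto simp: vs_def)
    qed
  qed (simp_all add: len, simp add: ps_def)
  then show ?thesis using ps_Y by (metis image_mono set_map)
qed

text \<open>Closes a circle of implications: no cycle, hence no joined spokes, hence a level choice,
  hence no cycle.\<close>

lemma indep_cycle_matroid_iff:
  assumes "Y \<subseteq> {..<length t}"
  shows "(!) es ` Y \<in> indep (cycle_matroid G) \<longleftrightarrow> (\<exists>g. level_choice t Y g)"
proof -
  have "(!) es ` Y \<subseteq> edges G"
    using assms hub_path_lengths[OF path] by (force simp: edges_eq)
  then have "(!) es ` Y \<in> indep (cycle_matroid G) \<longleftrightarrow>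
      \<not> (\<exists>vs cs. is_cycle G vs cs \<and> set cs \<subseteq> (!) es ` Y)" (is "_ \<longleftrightarrow> \<not> ?cycle")
    by (simp add: cycle_matroid_def)
  also have "\<dots> \<longleftrightarrow> (\<exists>g. level_choice t Y g)"
  proof
    assume "\<not> ?cycle"
    then show "\<exists>g. level_choice t Y g"
      using cycle_if_joined_spokes[OF assms] level_choice_exists[OF assms] by metis
  qed (use no_cycle_if_level_choice[OF assms] in metis)
  finally show ?thesis .
qed

end

text \<open>Element \<open>x\<close> goes to the edge at list index \<open>x - 1\<close>; on both
  sides independence means that the index set has a level choice.\<close>

lemma matroid_iso_hub_path_graph:
  assumes "hub_path_graph G h (East # w @ [East]) es R"
  shows "matroid_iso (lpm (East # w @ [North]) (North # w @ [East])) (cycle_matroid G)"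
    (is "matroid_iso ?M _")
proof -
  interpret hub_path_graph G h "East # w @ [East]" es R by (rule assms)
  let ?n = "length w + 2"
  have len: "length es = ?n" using hub_path_lengths[OF path] by simp
  have ground: "ground ?M = Suc ` {..<?n}" by (simp add: image_Suc_lessThan)
  have "bij_betw ((!) es) {..<?n} (edges G)"
    using distinct_edges edges_eq len by (intro bij_betw_nth) auto
  moreover have "bij_betw (\<lambda>x. x - 1) (Suc ` {..<?n}) {..<?n}"
    by (rule bij_betw_byWitness[where f' = Suc]) auto
  ultimately have bij: "bij_betw ((!) es \<circ> (\<lambda>x. x - 1)) (ground ?M) (ground (cycle_matroid G))"
    unfolding ground by (simp add: cycle_matroid_def bij_betw_trans)
  have "X \<in> indep ?M \<longleftrightarrow> ((!) es \<circ> (\<lambda>x. x - 1)) ` X \<in> indep (cycle_matroid G)"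
    if X: "X \<subseteq> ground ?M" for X
  proof -
    obtain Y where Y: "Y \<subseteq> {..<?n}" "X = Suc ` Y" using X unfolding ground by (rule subset_imageE)
    then have "((!) es \<circ> (\<lambda>x. x - 1)) ` X = (!) es ` Y" by (simp add: image_image)
    then show ?thesis using indep_boundary_iff[of Y w] indep_cycle_matroid_iff[of Y] Y by simp
  qed
  then show ?thesis using bij unfolding matroid_iso_def by blast
qed


section \<open>Multi-fans are paths with a hub\<close>

text \<open>The recursion follows \<open>d\<close>, and \<open>i\<close> numbers the current rim
  vertex; the base case adds the last bundle, for which \<open>c\<close> has one entry more.\<close>

fun fan_edge_seq :: "nat \<Rightarrow> nat list \<Rightarrow> nat list \<Rightarrow> fan_edge list" where
  "fan_edge_seq i c [] = map (Spoke i) [1..<Suc (hd c)]"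
| "fan_edge_seq i c (b # d) =
     map (Spoke i) [1..<Suc (hd c)] @ map (Path i) [1..<Suc b] @ fan_edge_seq (Suc i) (tl c) d"

fun fan_rim_seq :: "nat \<Rightarrow> nat list \<Rightarrow> fan_vertex list" where
  "fan_rim_seq i [] = [Rim i 1]"
| "fan_rim_seq i (b # d) = map (Rim i) [1..<Suc b] @ fan_rim_seq (Suc i) d"

fun fan_steps :: "nat list \<Rightarrow> nat list \<Rightarrow> step list" where
  "fan_steps c [] = replicate (hd c) East"
| "fan_steps c (b # d) = replicate (hd c) East @ replicate b North @ fan_steps (tl c) d"

section \<open>Membership and distinctness of the listed edges and vertices\<close>

lemma Spoke_in_fan_edge_seq:
  "length c = Suc (length d) \<Longrightarrow> Spoke m j \<in> set (fan_edge_seq i c d) \<longleftrightarrow>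
     i \<le> m \<and> m < i + length c \<and> 1 \<le> j \<and> j \<le> c ! (m - i)"
proof (induction d arbitrary: i c)
  case Nil
  then show ?case by (cases c) (auto simp del: upt_Suc)
next
  case (Cons b d)
  then obtain x c' where "c = x # c'" "length c' = Suc (length d)" by (cases c) auto
  then show ?case using Cons.IH[of c' "Suc i"] by (auto simp: nth_Cons' simp del: upt_Suc)
qed

lemma Path_in_fan_edge_seq:
  "Path m j \<in> set (fan_edge_seq i c d) \<longleftrightarrow>
     i \<le> m \<and> m < i + length d \<and> 1 \<le> j \<and> j \<le> d ! (m - i)"
  by (induction d arbitrary: i c) (auto simp: nth_Cons' simp del: upt_Suc)

lemma distinct_fan_edge_seq:
  "length c = Suc (length d) \<Longrightarrow> distinct (fan_edge_seq i c d)"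
proof (induction d arbitrary: i c)
  case (Cons b d)
  then have "length (tl c) = Suc (length d)" by simp
  then show ?case using Cons.IH[of "tl c" "Suc i"]
    by (auto simp: distinct_map inj_on_def Spoke_in_fan_edge_seq Path_in_fan_edge_seq simp del: upt_Suc)
qed (simp add: distinct_map inj_on_def del: upt_Suc)

lemma in_fan_rim_seq:
  "v \<in> set (fan_rim_seq i d) \<Longrightarrow> \<exists>m j. v = Rim m j \<and> i \<le> m \<and>
     (m = i + length d \<and> j = 1 \<or> m < i + length d \<and> 1 \<le> j \<and> j \<le> d ! (m - i))"
proof (induction d arbitrary: i)
  case (Cons b d)
  from Cons.prems consider j where "v = Rim i j" "1 \<le> j" "j \<le> b" | "v \<in> set (fan_rim_seq (Suc i) d)"
    by (auto simp del: upt_Suc)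
  then show ?case
  proof cases
    case 2
    from Cons.IH[OF this] show ?thesis by (fastforce simp: nth_Cons')
  qed auto
qed simp

lemma distinct_fan_rim_seq: "distinct (fan_rim_seq i d)"
proof (induction d arbitrary: i)
  case (Cons b d)
  then show ?case
    by (auto simp: distinct_map inj_on_def simp del: upt_Suc dest: in_fan_rim_seq)
qed simp

text \<open>Exposes the vertex at which the next bundle attaches; an empty rim path would drop
  it.\<close>

lemma fan_rim_seq_Cons:
  assumes "\<forall>b\<in>set d. 1 \<le> b"
  shows "\<exists>R. fan_rim_seq i d = Rim i 1 # R"
  using assms by (cases d) (auto simp: upt_conv_Cons simp del: upt_Suc)

section \<open>Assembly of the hub path of a multi-fan\<close>

lemma hub_path_spokes:
  assumes "hub_path (fan_ends D) Hub t es (Rim i 1 # R)"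
  shows "hub_path (fan_ends D) Hub (replicate (length js) East @ t) (map (Spoke i) js @ es) (Rim i 1 # R)"
  using assms by (induction js) (auto intro: hub_path_East)

lemma hub_path_rim:
  assumes "hub_path (fan_ends D) Hub t es (Rim (Suc i) 1 # R)" "D ! (i - 1) = b" "j \<le> Suc b"
  shows "hub_path (fan_ends D) Hub (replicate (Suc b - j) North @ t) (map (Path i) [j..<Suc b] @ es)
           (map (Rim i) [j..<Suc b] @ Rim (Suc i) 1 # R)"
  using assms(3)
\<comment> \<open>\<open>j\<close> runs down from \<open>Suc b\<close>, since a hub path grows at
  its front.\<close>
proof (induction j rule: inc_induct)
  case (step j)
  have upt: "[j..<Suc b] = j # [Suc j..<Suc b]" and diff: "Suc b - j = Suc (Suc b - Suc j)"
    using step by (simp_all add: upt_conv_Cons del: upt_Suc)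
  show ?case
  \<comment> \<open>Only the last edge of the rim path ends in \<open>Rim (Suc i) 1\<close>.\<close>
  proof (cases "j = b")
    case True
    then show ?thesis using assms by (auto intro: hub_path_North)
  next
    case False
    then have "[Suc j..<Suc b] = Suc j # [Suc (Suc j)..<Suc b]"
      using step by (simp add: upt_conv_Cons del: upt_Suc)
    then show ?thesis using step.IH assms(2) False step.hyps unfolding upt diff
      by (auto intro!: hub_path_North simp del: upt_Suc)
  qed
qed (use assms in simp)

text \<open>\<open>D\<close> is the whole list of rim lengths, which fixes \<open>fan_ends\<close>,
  while the induction consumes its segment \<open>d\<close>, starting at entry \<open>i\<close>
  counted from 1.\<close>

lemma hub_path_fan:
  assumes "length c = Suc (length d)" "\<forall>b\<in>set d. 1 \<le> b" "\<And>m. m < length d \<Longrightarrow> D ! (i + m - 1) = d ! m"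
  shows "hub_path (fan_ends D) Hub (fan_steps c d) (fan_edge_seq i c d) (fan_rim_seq i d)"
  using assms
proof (induction d arbitrary: i c)
  case Nil
  show ?case using hub_path_spokes[OF hub_path_end, where D = D and i = i and js = "[1..<Suc (hd c)]"] by (simp del: upt_Suc)
next
  case (Cons b d)
  obtain R where R: "fan_rim_seq (Suc i) d = Rim (Suc i) 1 # R"
    using fan_rim_seq_Cons[of d "Suc i"] Cons.prems by auto
  have "D ! (Suc i + m - 1) = d ! m" if "m < length d" for m
    using Cons.prems(3)[of "Suc m"] that by simp
  then have IH: "hub_path (fan_ends D) Hub (fan_steps (tl c) d) (fan_edge_seq (Suc i) (tl c) d)
      (Rim (Suc i) 1 # R)"
    using Cons.IH[of "tl c" "Suc i"] Cons.prems R by simp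
  have b: "D ! (i - 1) = b" "1 \<le> b" using Cons.prems(2) Cons.prems(3)[of 0] by simp_all
  have "[1..<Suc b] = 1 # [2..<Suc b]"
    using b by (simp add: upt_conv_Cons numeral_2_eq_2 del: upt_Suc)
  then have rim: "map (Rim i) [1..<Suc b] @ R' = Rim i 1 # map (Rim i) [2..<Suc b] @ R'" for R'
    by simp
  have *: "hub_path (fan_ends D) Hub (replicate b North @ fan_steps (tl c) d)
      (map (Path i) [1..<Suc b] @ fan_edge_seq (Suc i) (tl c) d)
      (map (Rim i) [1..<Suc b] @ Rim (Suc i) 1 # R)"
    using hub_path_rim[OF IH b(1), of 1] by (simp del: upt_Suc)
  show ?case
    using hub_path_spokes[OF *[unfolded rim], of "[1..<Suc (hd c)]", folded rim] R by (simp del: upt_Suc)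
qed

lemma hub_path_graph_multi_fan:
  assumes "length c = Suc (length d)" "\<forall>b\<in>set d. 1 \<le> b"
  shows "hub_path_graph (multi_fan c d) Hub (fan_steps c d) (fan_edge_seq 1 c d) (fan_rim_seq 1 d)"
proof
  show "hub_path (ends (multi_fan c d)) Hub (fan_steps c d) (fan_edge_seq 1 c d) (fan_rim_seq 1 d)"
    using hub_path_fan[OF assms, of d 1] by (simp add: multi_fan_def)
  show "distinct (fan_edge_seq 1 c d)" using assms(1) by (rule distinct_fan_edge_seq)
  show "edges (multi_fan c d) = set (fan_edge_seq 1 c d)"
  proof (rule set_eqI)
    fix e
    show "e \<in> edges (multi_fan c d) \<longleftrightarrow> e \<in> set (fan_edge_seq 1 c d)"
      by (cases e) (auto simp: multi_fan_def Spoke_in_fan_edge_seq[OF assms(1)] Path_in_fan_edge_seq)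
  qed
  show "distinct (Hub # fan_rim_seq 1 d)" by (auto simp: distinct_fan_rim_seq dest: in_fan_rim_seq)
  show "set (Hub # fan_rim_seq 1 d) \<subseteq> verts (multi_fan c d)"
    using assms(1) by (auto simp: multi_fan_def dest!: in_fan_rim_seq)
qed


section \<open>The fan of a snake\<close>

text \<open>
  The spoke counts of a snake without the first element of its ground set, which is a further spoke
  at the first vertex.
\<close>

fun snake_spokes :: "nat list \<Rightarrow> nat list" where
  "snake_spokes [] = [1]"
| "snake_spokes [b] = [b]"
| "snake_spokes (b # b' # a) = (b - 1) # snake_spokes a"

fun snake_rims :: "nat list \<Rightarrow> nat list" where
  "snake_rims (b # b' # a) = (b' - 1) # snake_rims a"
| "snake_rims _ = []"

lemma length_snake_spokes: "length (snake_spokes a) = Suc (length (snake_rims a))"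
  by (induction a rule: snake_spokes.induct) auto

text \<open>Groups share a square, so \<open>b\<close> squares give \<open>b - 1\<close> steps. The
  final \<open>East\<close> completes a last horizontal group to \<open>b\<close> spokes, or is the
  only spoke after a last vertical group.\<close>

lemma fan_steps_snake:
  "\<forall>b\<in>set a. 1 \<le> b \<Longrightarrow> fan_steps (snake_spokes a) (snake_rims a) = walk East a @ [East]"
proof (induction a rule: snake_spokes.induct)
  case (2 b)
  then show ?case by (cases b) (auto simp: replicate_append_same)
qed auto

lemma fan_steps_Suc: "fan_steps (Suc x # c) d = East # fan_steps (x # c) d"
  by (cases d) auto

lemma snake_spokes_eq:
  "snake_spokes a = map (\<lambda>i. a ! (2 * i) - 1) [0..<length a div 2] @
     [if odd (length a) then a ! (2 * (length a div 2)) else 1]"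
proof (induction a rule: snake_spokes.induct)
  case (3 b b' a)
  \<comment> \<open>For odd length, \<open>2 * (length a div 2)\<close> is
    \<open>length a - 1\<close>; the two entries in front shift this index by two.\<close>
  have "odd (length a) \<Longrightarrow> (b' # a) ! length a = a ! (length a - 1)"
    by (cases a) auto
  then show ?case unfolding snake_spokes.simps 3
    by (simp add: map_upt_Suc del: upt_Suc)
qed auto

lemma snake_rims_eq: "snake_rims a = map (\<lambda>i. a ! (2 * i + 1) - 1) [0..<length a div 2]"
proof (induction a rule: snake_rims.induct)
  case (1 b b' a)
  show ?case unfolding snake_rims.simps 1
    by (simp add: map_upt_Suc del: upt_Suc)
qed auto

theorem theorem3p2:
  fixes a c d :: "nat list" and n k :: nat
  assumes "n = length a" and "n \<ge> 1"
    and "a ! 0 \<ge> 1" and "\<forall>i. 1 \<le> i \<and> i < n \<longrightarrow> a ! i \<ge> 2"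
    and "k = n div 2"
    and "c = (if n = 1 then [a ! 0 + 1]
              else if odd n then [a ! 0] @ map (\<lambda>i. a ! (2 * i) - 1) [1..<k] @ [a ! (2 * k)]
              else [a ! 0] @ map (\<lambda>i. a ! (2 * i) - 1) [1..<k] @ [1])"
    and "d = map (\<lambda>i. a ! (2 * i - 1) - 1) [1..<Suc k]"
  shows "matroid_iso (snake a) (cycle_matroid (multi_fan c d))"
proof -
  have d: "d = snake_rims a"
    unfolding snake_rims_eq assms(7) assms(5)[unfolded assms(1), symmetric]
    by (simp add: map_Suc_upt[symmetric] del: upt_Suc map_Suc_upt)
  obtain x cs where spokes: "snake_spokes a = x # cs"
    using length_snake_spokes[of a] by (cases "snake_spokes a") auto
  \<comment> \<open>The additional spoke is the first \<open>East\<close> of the step list: it gives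
    \<open>a ! 0 + 1\<close> for \<open>n = 1\<close> and otherwise undoes the subtraction in
    \<open>a ! 0 - 1\<close>.\<close>
  have c: "c = Suc x # cs"
  proof (cases "n = 1")
    case True
    then have "k = 0" "length a div 2 = 0" using assms(1,5) by auto
    then show ?thesis using True assms(1,6) spokes snake_spokes_eq[of a] by simp
  next
    case False
    then have "0 < k" using assms(2,5) by linarith
    then have "[0..<k] = 0 # [1..<k]" by (simp add: upt_conv_Cons)
    moreover have "Suc (a ! 0 - 1) = a ! 0" using assms(3) by simp
    ultimately show ?thesis
      using False assms(6) spokes snake_spokes_eq[of a] assms(1,5) by auto
  qed
  have "a \<noteq> []" using assms(1,2) by auto
  have pos: "\<forall>b\<in>set a. 1 \<le> b"
  proof
    fix b assume "b \<in> set a"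
    then obtain i where "i < n" "b = a ! i" using assms(1) by (auto simp: in_set_conv_nth)
    then show "1 \<le> b" using assms(3) assms(4)[rule_format, of i] by (cases "i = 0") auto
  qed
  \<comment> \<open>The index \<open>2 * i - 1\<close> is at least 1, so the bound 2 applies and
    every rim path has an edge.\<close>
  have "1 \<le> a ! (2 * i - 1) - 1" if "1 \<le> i" "i \<le> k" for i
  proof -
    have "1 \<le> 2 * i - 1" "2 * i - 1 < n" using that assms(5) by linarith+
    then have "2 \<le> a ! (2 * i - 1)" using assms(4) by blast
    then show ?thesis by simp
  qed
  then have "\<forall>b\<in>set d. 1 \<le> b" unfolding assms(7) by (auto simp del: upt_Suc)
  moreover have "length c = Suc (length d)" using length_snake_spokes[of a] spokes by (simp add: c d)
  ultimately have "hub_path_graph (multi_fan c d) Hub (fan_steps c d) (fan_edge_seq 1 c d) (fan_rim_seq 1 d)"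
    by (intro hub_path_graph_multi_fan)
  moreover have "fan_steps c d = East # walk East a @ [East]"
    using fan_steps_snake[OF pos] spokes by (simp add: c d fan_steps_Suc)
  ultimately show ?thesis
    using matroid_iso_hub_path_graph snake_eq_lpm[OF \<open>a \<noteq> []\<close> pos]
    by (simp add: lower_path_def upper_path_def)
qed

end
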